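(* Let $N_{\max}\ge1$ be an integer, let $\mathscr{H}=\bigoplus_{N=0}^{N_{\max}}\mathscr{H}^{(N)}$ be the truncated (bosonic or fermionic) Fock space over $L^2(\mathbb{R}^3,\mathbb{C}^4)$, and let $(\tilde H,\tilde D)$ be an essentially self-adjoint operator in $\mathscr{H}^{(N_{\max})}$. Let $$D^\circ:=\{0\}\oplus\cdots\oplus\{0\}\oplus\tilde D\subset\mathscr{H}$$ and let $H^\circ:D^\circ\to\mathscr{H}$ be given by $$H^\circ\bigl(0,\ldots,0,\psi^{(N_{\max})}\bigr):=\bigl(0,\ldots,0,\tilde H\psi^{(N_{\max})}\bigr).$$ Then for every self-adjoint extension $(H,D)$ of $(H^\circ,D^\circ)$ in $\mathscr{H}$, the highest sector decouples from the other sectors. In fact, with respect to the decomposition $\mathscr{H}=\mathscr{H}^{(<N_{\max})}\oplus\mathscr{H}^{(N_{\max})}$, where $\mathscr{H}^{(<N_{\max})}=\mathscr{H}^{(0)}\oplus\cdots\oplus\mathscr{H}^{(N_{\max}-1)}$, one has $D=D^{(<N_{\max})}\oplus D^{(N_{\max})}$, and $H$ is block diagonal with blocks $H^{(<N_{\max})}:D^{(<N_{\max})}\to\mathscr{H}^{(<N_{\max})}$ and $H^{(N_{\max})}:D^{(N_{\max})}\to\mathscr{H}^{(N_{\max})}$, where $(H^{(N_{\max})},D^{(N_{\max})})$ is the unique self-adjoint extension of $(\tilde H,\tilde D)$ in $\mathscr{H}^{(N_{\max})}$.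
   Context: Fock space: $\mathscr{H}^{(0)}=\mathbb{C}$ and $\mathscr{H}^{(N)}=S_\pm\,L^2(\mathbb{R}^3,\mathbb{C}^4)^{\otimes N}$, where the sign is fixed and $S_+$ (resp. $S_-$) is the symmetrization (resp. anti-symmetrization) operator; elements of $\mathscr{H}$ are $\psi=(\psi^{(0)},\ldots,\psi^{(N_{\max})})$. For subspaces that are not Hilbert spaces, $\oplus$ denotes the Cartesian product as a subset of $\mathscr{H}$. "Self-adjoint" and "essentially self-adjoint" include "densely defined" (in the respective Hilbert space); $D^\circ$ itself is not dense in $\mathscr{H}$. A self-adjoint extension of $(H^\circ,D^\circ)$ is a self-adjoint operator $(H,D)$ in $\mathscr{H}$ with $D^\circ\subset D$ and $H|_{D^\circ}=H^\circ$. Block diagonal with blocks $H_a,H_b$ on $D=D_a\oplus D_b$ means $H(\psi_a,\psi_b)=(H_a\psi_a,H_b\psi_b)$ for all $\psi_a\in D_a,\psi_b\in D_b$. *)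

theory Defs
  imports
    "HOL-Analysis.Analysis"
    "HOL-Combinatorics.Permutations"
begin

section \<open>Complex inner product spaces with explicit carrier\<close>

text \<open>
  The sectors of Fock space depend on the particle number, which is a value and not a type.
  Hence the spaces are records with an explicit carrier set. The inner product is
  antilinear in its first argument.
\<close>

record 'v inner_space =
  carrier :: "'v set"
  vzero :: 'v
  vadd :: "'v \<Rightarrow> 'v \<Rightarrow> 'v"
  vscale :: "complex \<Rightarrow> 'v \<Rightarrow> 'v"
  cinner :: "'v \<Rightarrow> 'v \<Rightarrow> complex"

definition vdist :: "'v inner_space \<Rightarrow> 'v \<Rightarrow> 'v \<Rightarrow> real" where
  "vdist V x y =
    (let d = vadd V x (vscale V (-1) y) in sqrt (Re (cinner V d d)))"

definition closure_in :: "'v inner_space \<Rightarrow> 'v set \<Rightarrow> 'v set" where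
  "closure_in V S = {x \<in> carrier V. \<forall>e>0. \<exists>y\<in>S. vdist V x y < e}"

definition linear_subspace :: "'v inner_space \<Rightarrow> 'v set \<Rightarrow> bool" where
  "linear_subspace V D \<longleftrightarrow>
    D \<subseteq> carrier V \<and> vzero V \<in> D \<and>
    (\<forall>x\<in>D. \<forall>y\<in>D. vadd V x y \<in> D) \<and> (\<forall>a. \<forall>x\<in>D. vscale V a x \<in> D)"

definition dense_in :: "'v inner_space \<Rightarrow> 'v set \<Rightarrow> bool" where
  "dense_in V D \<longleftrightarrow> D \<subseteq> carrier V \<and> closure_in V D = carrier V"

text \<open>The sum over \<open>I\<close> is orthogonal and is only meant for finite \<open>I\<close>.\<close>

definition direct_sum :: "'i set \<Rightarrow> ('i \<Rightarrow> 'v inner_space) \<Rightarrow> ('i \<Rightarrow> 'v) inner_space" where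
  "direct_sum I V =
    \<lparr> carrier = (\<Pi>\<^sub>E i\<in>I. carrier (V i)),
      vzero = (\<lambda>i\<in>I. vzero (V i)),
      vadd = (\<lambda>x y. \<lambda>i\<in>I. vadd (V i) (x i) (y i)),
      vscale = (\<lambda>a x. \<lambda>i\<in>I. vscale (V i) a (x i)),
      cinner = (\<lambda>x y. \<Sum>i\<in>I. cinner (V i) (x i) (y i)) \<rparr>"


section \<open>Unbounded operators\<close>

text \<open>
  An operator is given by a function and its domain; values of the function outside the domain
  are irrelevant. Operators are not assumed to be densely defined.
\<close>

definition linear_operator :: "'v inner_space \<Rightarrow> ('v \<Rightarrow> 'v) \<Rightarrow> 'v set \<Rightarrow> bool" where
  "linear_operator V T D \<longleftrightarrow>
    linear_subspace V D \<and> T ` D \<subseteq> carrier V \<and>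
    (\<forall>x\<in>D. \<forall>y\<in>D. T (vadd V x y) = vadd V (T x) (T y)) \<and>
    (\<forall>a. \<forall>x\<in>D. T (vscale V a x) = vscale V a (T x))"

definition symmetric_operator :: "'v inner_space \<Rightarrow> ('v \<Rightarrow> 'v) \<Rightarrow> 'v set \<Rightarrow> bool" where
  "symmetric_operator V T D \<longleftrightarrow>
    linear_operator V T D \<and> dense_in V D \<and>
    (\<forall>x\<in>D. \<forall>y\<in>D. cinner V (T x) y = cinner V x (T y))"

definition adjoint_dom :: "'v inner_space \<Rightarrow> ('v \<Rightarrow> 'v) \<Rightarrow> 'v set \<Rightarrow> 'v set" where
  "adjoint_dom V T D =
    {y \<in> carrier V. \<exists>z\<in>carrier V. \<forall>x\<in>D. cinner V y (T x) = cinner V z x}"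

definition adjoint_op :: "'v inner_space \<Rightarrow> ('v \<Rightarrow> 'v) \<Rightarrow> 'v set \<Rightarrow> 'v \<Rightarrow> 'v" where
  "adjoint_op V T D y =
    (THE z. z \<in> carrier V \<and> (\<forall>x\<in>D. cinner V y (T x) = cinner V z x))"

definition self_adjoint :: "'v inner_space \<Rightarrow> ('v \<Rightarrow> 'v) \<Rightarrow> 'v set \<Rightarrow> bool" where
  "self_adjoint V T D \<longleftrightarrow>
    linear_operator V T D \<and> dense_in V D \<and>
    adjoint_dom V T D = D \<and> (\<forall>x\<in>D. adjoint_op V T D x = T x)"

text \<open>The closure of the graph of an operator, with respect to the product topology.\<close>

definition graph_closure ::
    "'v inner_space \<Rightarrow> ('v \<Rightarrow> 'v) \<Rightarrow> 'v set \<Rightarrow> ('v \<times> 'v) set" where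
  "graph_closure V T D =
    {(y, z) \<in> carrier V \<times> carrier V. \<forall>e>0. \<exists>x\<in>D. vdist V y x < e \<and> vdist V z (T x) < e}"

definition closure_dom :: "'v inner_space \<Rightarrow> ('v \<Rightarrow> 'v) \<Rightarrow> 'v set \<Rightarrow> 'v set" where
  "closure_dom V T D = Domain (graph_closure V T D)"

text \<open>
  The closure is only used for symmetric operators: these are closable, that is, the closure
  of the graph is single-valued.
\<close>

definition closure_op :: "'v inner_space \<Rightarrow> ('v \<Rightarrow> 'v) \<Rightarrow> 'v set \<Rightarrow> 'v \<Rightarrow> 'v" where
  "closure_op V T D y = (THE z. (y, z) \<in> graph_closure V T D)"

definition essentially_self_adjoint ::
    "'v inner_space \<Rightarrow> ('v \<Rightarrow> 'v) \<Rightarrow> 'v set \<Rightarrow> bool" where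
  "essentially_self_adjoint V T D \<longleftrightarrow>
    symmetric_operator V T D \<and> self_adjoint V (closure_op V T D) (closure_dom V T D)"

definition self_adjoint_extension ::
    "'v inner_space \<Rightarrow> ('v \<Rightarrow> 'v) \<Rightarrow> 'v set \<Rightarrow> ('v \<Rightarrow> 'v) \<Rightarrow> 'v set \<Rightarrow> bool" where
  "self_adjoint_extension V T\<^sub>0 D\<^sub>0 T D \<longleftrightarrow>
    self_adjoint V T D \<and> D\<^sub>0 \<subseteq> D \<and> (\<forall>x\<in>D\<^sub>0. T x = T\<^sub>0 x)"

definition unique_self_adjoint_extension ::
    "'v inner_space \<Rightarrow> ('v \<Rightarrow> 'v) \<Rightarrow> 'v set \<Rightarrow> ('v \<Rightarrow> 'v) \<Rightarrow> 'v set \<Rightarrow> bool" where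
  "unique_self_adjoint_extension V T\<^sub>0 D\<^sub>0 T D \<longleftrightarrow>
    self_adjoint_extension V T\<^sub>0 D\<^sub>0 T D \<and>
    (\<forall>T' D'. self_adjoint_extension V T\<^sub>0 D\<^sub>0 T' D' \<longrightarrow> D' = D \<and> (\<forall>x\<in>D. T' x = T x))"


section \<open>Complex square-integrable functions modulo null sets\<close>

definition square_integrable :: "'a measure \<Rightarrow> ('a \<Rightarrow> 'b::{real_normed_vector}) \<Rightarrow> bool" where
  "square_integrable M f \<longleftrightarrow>
    f \<in> borel_measurable M \<and> integrable M (\<lambda>x. (norm (f x))\<^sup>2)"

definition ae_rel :: "'a measure \<Rightarrow> (('a \<Rightarrow> complex) \<times> ('a \<Rightarrow> complex)) set" where
  "ae_rel M =
    {(f, g). square_integrable M f \<and> square_integrable M g \<and> (AE x in M. f x = g x)}"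

definition ae_class :: "'a measure \<Rightarrow> ('a \<Rightarrow> complex) \<Rightarrow> ('a \<Rightarrow> complex) set" where
  "ae_class M f = ae_rel M `` {f}"

definition rep :: "('a \<Rightarrow> complex) set \<Rightarrow> 'a \<Rightarrow> complex" where
  "rep F = (SOME f. f \<in> F)"

definition L2 :: "'a measure \<Rightarrow> ('a \<Rightarrow> complex) set inner_space" where
  "L2 M =
    \<lparr> carrier = {f. square_integrable M f} // ae_rel M,
      vzero = ae_class M (\<lambda>x. 0),
      vadd = (\<lambda>F G. ae_class M (\<lambda>x. rep F x + rep G x)),
      vscale = (\<lambda>a F. ae_class M (\<lambda>x. a * rep F x)),
      cinner = (\<lambda>F G. LINT x|M. cnj (rep F x) * rep G x) \<rparr>"


section \<open>Truncated Fock space over \<open>L\<^sup>2(\<real>\<^sup>3, \<complex>\<^sup>4)\<close>\<close>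

text \<open>
  An \<open>N\<close>-particle wave function with values in the \<open>N\<close>-fold tensor power of \<open>\<complex>\<^sup>4\<close> is
  represented by its components, that is, as a complex function of the positions and spin indices
  \<open>(x\<^sub>i, s\<^sub>i)\<close> of the particles \<open>i < N\<close>, with counting measure on the spin indices.
\<close>

type_synonym config = "nat \<Rightarrow> (real ^ 3) \<times> 4"

definition config_measure :: "nat \<Rightarrow> config measure" where
  "config_measure N = (\<Pi>\<^sub>M i\<in>{..<N}. lborel \<Otimes>\<^sub>M count_space UNIV)"

definition tensor :: "nat \<Rightarrow> (nat \<Rightarrow> real ^ 3 \<Rightarrow> complex ^ 4) \<Rightarrow> config \<Rightarrow> complex" where
  "tensor N f c = (\<Prod>i<N. f i (fst (c i)) $ snd (c i))"

definition elementary_tensors :: "nat \<Rightarrow> (config \<Rightarrow> complex) set" where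
  "elementary_tensors N =
    {tensor N f | f. \<forall>i<N. square_integrable (lborel :: (real ^ 3) measure) (f i)}"

definition tensor_span :: "nat \<Rightarrow> (config \<Rightarrow> complex) set" where
  "tensor_span N =
    {(\<lambda>c. \<Sum>k<n. a k * t k c) | (n :: nat) a t. \<forall>k<n. t k \<in> elementary_tensors N}"

text \<open>
  By Fubini's theorem, the inner product of two elementary tensors is the product of the inner
  products of their factors. The Hilbert space tensor power is therefore realised as the closed
  linear span of the elementary tensors. For \<open>N = 0\<close>, the measure space is a single point of mass
  \<open>1\<close>, and the space consists of the constants.
\<close>

definition tensor_power :: "nat \<Rightarrow> (config \<Rightarrow> complex) set set" where
  "tensor_power N =
    closure_in (L2 (config_measure N)) (ae_class (config_measure N) ` tensor_span N)"

datatype statistics = Bosonic | Fermionic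

fun exchange_sign :: "statistics \<Rightarrow> (nat \<Rightarrow> nat) \<Rightarrow> complex" where
  "exchange_sign Bosonic p = 1"
| "exchange_sign Fermionic p = of_int (sign p)"

definition symmetrize :: "statistics \<Rightarrow> nat \<Rightarrow> (config \<Rightarrow> complex) \<Rightarrow> config \<Rightarrow> complex" where
  "symmetrize stat N f c =
    (\<Sum>p | p permutes {..<N}. exchange_sign stat p * f (c \<circ> p)) / fact N"

text \<open>Permutations preserve the configuration measure, so this does not depend on the
  representative.\<close>

definition sym_op ::
    "statistics \<Rightarrow> nat \<Rightarrow> (config \<Rightarrow> complex) set \<Rightarrow> (config \<Rightarrow> complex) set" where
  "sym_op stat N F = ae_class (config_measure N) (symmetrize stat N (rep F))"

definition sector :: "statistics \<Rightarrow> nat \<Rightarrow> (config \<Rightarrow> complex) set inner_space" where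
  "sector stat N =
    (L2 (config_measure N)) \<lparr> carrier := sym_op stat N ` tensor_power N \<rparr>"

text \<open>
  Elements are families indexed by the particle number, with value \<open>undefined\<close> outside the range
  of indices. An element \<open>\<psi>\<^sub>a\<close> of the sum of the sectors below \<open>N\<close> and an element \<open>\<psi>\<^sub>b\<close> of the sector
  \<open>N\<close> are combined to the pair \<open>\<psi>\<^sub>a(N := \<psi>\<^sub>b)\<close> in the Fock space truncated at \<open>N\<close>.
\<close>

definition fock :: "statistics \<Rightarrow> nat \<Rightarrow> (nat \<Rightarrow> (config \<Rightarrow> complex) set) inner_space" where
  "fock stat N = direct_sum {..N} (sector stat)"

definition fock_below :: "statistics \<Rightarrow> nat \<Rightarrow> (nat \<Rightarrow> (config \<Rightarrow> complex) set) inner_space" where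
  "fock_below stat N = direct_sum {..<N} (sector stat)"

end

theory Submission
  imports Defs
begin

text \<open>
  For \<open>\<psi>\<close> in the domain \<open>D\<close> of a self-adjoint extension \<open>H\<close>, testing the symmetry of \<open>H\<close> against
  the vectors \<open>(0, \<phi>)\<close> with \<open>\<phi> \<in> Dt\<close> shows that the top component of \<open>\<psi>\<close> lies in the domain of the
  adjoint of \<open>Ht\<close>, which acts on it as the top component of \<open>H \<psi>\<close>. By essential self-adjointness this
  adjoint is the closure \<open>T\<close> of \<open>Ht\<close>. Now if \<open>\<xi>\<close> is in the domain of \<open>T\<close>, symmetry of \<open>T\<close> gives
  \<open>\<langle>(0, \<xi>), H \<eta>\<rangle> = \<langle>(0, T \<xi>), \<eta>\<rangle>\<close> for all \<open>\<eta> \<in> D\<close>, so that \<open>(0, \<xi>) \<in> D\<close> and \<open>H (0, \<xi>) = (0, T \<xi>)\<close>.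
  Subtracting \<open>(0, \<xi>)\<close> from the elements of \<open>D\<close> splits \<open>D\<close> and \<open>H\<close>.
\<close>

section \<open>Inner product spaces inside an ambient space\<close>

text \<open>
  The carrier need not be closed under the operations: only the ambient set \<open>A\<close> is. For the sectors of
  Fock space, \<open>A\<close> is the full \<open>L\<^sup>2\<close> space, so that the (anti-)symmetric tensor power never has to be
  shown to be a subspace. The vector space axioms follow from \<open>definite\<close> and sesquilinearity.
\<close>

locale inner_space_within =
  fixes V :: "'v inner_space" and A :: "'v set"
  assumes carrier_subset: "carrier V \<subseteq> A"
    and vzero_in: "vzero V \<in> A"
    and vadd_in: "\<And>x y. x \<in> A \<Longrightarrow> y \<in> A \<Longrightarrow> vadd V x y \<in> A"
    and vscale_in: "\<And>a x. x \<in> A \<Longrightarrow> vscale V a x \<in> A"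
    and cinner_zero_right: "\<And>x. x \<in> A \<Longrightarrow> cinner V x (vzero V) = 0"
    and cinner_add_right: "\<And>x y z. x \<in> A \<Longrightarrow> y \<in> A \<Longrightarrow> z \<in> A \<Longrightarrow>
          cinner V x (vadd V y z) = cinner V x y + cinner V x z"
    and cinner_scale_right: "\<And>a x y. x \<in> A \<Longrightarrow> y \<in> A \<Longrightarrow>
          cinner V x (vscale V a y) = a * cinner V x y"
    and cinner_commute: "\<And>x y. x \<in> A \<Longrightarrow> y \<in> A \<Longrightarrow> cinner V y x = cnj (cinner V x y)"
    and cinner_nonneg: "\<And>x. x \<in> A \<Longrightarrow> 0 \<le> Re (cinner V x x)"
    and definite: "\<And>x y. x \<in> A \<Longrightarrow> y \<in> A \<Longrightarrow>
          cinner V (vadd V x (vscale V (-1) y)) (vadd V x (vscale V (-1) y)) = 0 \<Longrightarrow> x = y"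
begin

abbreviation vdiff :: "'v \<Rightarrow> 'v \<Rightarrow> 'v" where
  "vdiff x y \<equiv> vadd V x (vscale V (-1) y)"

lemma vdiff_in: "x \<in> A \<Longrightarrow> y \<in> A \<Longrightarrow> vdiff x y \<in> A"
  by (simp add: vadd_in vscale_in)

lemma cinner_zero_left: "x \<in> A \<Longrightarrow> cinner V (vzero V) x = 0"
  by (metis cinner_commute cinner_zero_right complex_cnj_zero vzero_in)

lemma cinner_add_left:
  "x \<in> A \<Longrightarrow> y \<in> A \<Longrightarrow> z \<in> A \<Longrightarrow> cinner V (vadd V x y) z = cinner V x z + cinner V y z"
  by (metis cinner_add_right cinner_commute complex_cnj_add vadd_in)

lemma cinner_scale_left:
  "x \<in> A \<Longrightarrow> y \<in> A \<Longrightarrow> cinner V (vscale V a x) y = cnj a * cinner V x y"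
  by (metis cinner_scale_right cinner_commute complex_cnj_mult vscale_in)

lemmas cinner_linear =
  cinner_zero_left cinner_zero_right cinner_add_left cinner_add_right
  cinner_scale_left cinner_scale_right vzero_in vadd_in vscale_in

text \<open>Testing with the difference of the two vectors makes its norm vanish, and
  \<open>definite\<close> applies. Identities between vectors thereby reduce to sesquilinearity of
  the inner product.\<close>

lemma cinner_eqI:
  assumes "x \<in> A" "y \<in> A" "\<And>w. w \<in> A \<Longrightarrow> cinner V x w = cinner V y w"
  shows "x = y"
proof (rule definite[OF assms(1,2)])
  have "cinner V x (vdiff x y) = cinner V y (vdiff x y)"
    using assms(1,2) by (intro assms(3) vdiff_in)
  then show "cinner V (vdiff x y) (vdiff x y) = 0"
    using assms(1,2) vdiff_in[OF assms(1,2)] by (subst cinner_add_left) (simp_all add: cinner_scale_left vscale_in)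
qed

lemma vadd_zero_right: "x \<in> A \<Longrightarrow> vadd V x (vzero V) = x"
  by (rule cinner_eqI) (simp_all add: cinner_linear)

lemma vadd_zero_left: "x \<in> A \<Longrightarrow> vadd V (vzero V) x = x"
  by (rule cinner_eqI) (simp_all add: cinner_linear)

lemma vscale_vzero: "vscale V a (vzero V) = vzero V"
  by (rule cinner_eqI) (simp_all add: cinner_linear)

lemma vdiff_self: "x \<in> A \<Longrightarrow> vdiff x x = vzero V"
  by (rule cinner_eqI) (simp_all add: cinner_linear)

text \<open>The squared norm of \<open>x\<close> minus a multiple of \<open>y\<close> is
  nonnegative; along a suitable line of multiples it is a real quadratic polynomial in
  \<open>t\<close>.\<close>

lemma cauchy_schwarz:
  assumes x: "x \<in> A" and y: "y \<in> A"
  shows "(norm (cinner V x y))\<^sup>2 \<le> Re (cinner V x x) * Re (cinner V y y)"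
proof -
  define c where "c = cinner V x y"
  have quad: "0 \<le> Re (cinner V x x) - 2 * t * (norm c)\<^sup>2 + t\<^sup>2 * (norm c)\<^sup>2 * Re (cinner V y y)"
    for t :: real
  proof -
    \<comment> \<open>The factor \<open>cnj c\<close> cancels the phase of
      \<open>cinner V x y\<close>, so that both cross terms are real and equal \<open>- t\<close>
      times the squared modulus of \<open>c\<close>.\<close>
    let ?a = "- of_real t * cnj c"
    have yx: "cinner V y x = cnj c"
      using cinner_commute[OF x y] by (simp add: c_def)
    have yy: "Im (cinner V y y) = 0"
      using cinner_commute[OF y y] by (metis complex_cnj_cancel_iff Reals_cnj_iff complex_is_Real_iff)
    have "cinner V (vadd V x (vscale V ?a y)) (vadd V x (vscale V ?a y)) =
        cinner V x x + ?a * c + cnj ?a * (cnj c + ?a * cinner V y y)"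
      using x y by (simp add: cinner_linear yx flip: c_def) (simp add: algebra_simps)
    then have "Re (cinner V (vadd V x (vscale V ?a y)) (vadd V x (vscale V ?a y))) =
        Re (cinner V x x) - 2 * t * (norm c)\<^sup>2 + t\<^sup>2 * (norm c)\<^sup>2 * Re (cinner V y y)"
      by (simp add: yy cmod_power2) (simp add: power2_eq_square algebra_simps)
    then show ?thesis
      using cinner_nonneg[of "vadd V x (vscale V ?a y)"] x y by (simp add: vadd_in vscale_in)
  qed
  show ?thesis
  proof (cases "Re (cinner V y y) = 0")
    case True
    have "(norm c)\<^sup>2 = 0"
    proof (rule ccontr)
      assume "(norm c)\<^sup>2 \<noteq> 0"
      \<comment> \<open>For \<open>y\<close> of norm zero the polynomial is affine in
        \<open>t\<close>; the chosen \<open>t\<close> would give it the value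
        \<open>- Re (cinner V x x) - 2\<close>.\<close>
      then show False
        using quad[of "(Re (cinner V x x) + 1) / (norm c)\<^sup>2"] cinner_nonneg[OF x] True by simp
    qed
    then show ?thesis
      using True by (simp flip: c_def)
  next
    case False
    then have "0 < Re (cinner V y y)"
      using cinner_nonneg[OF y] by simp
    \<comment> \<open>This \<open>t\<close> minimises the polynomial when \<open>c\<close> is
      nonzero.\<close>
    then show ?thesis
      using quad[of "1 / Re (cinner V y y)"]
      by (simp add: power2_eq_square field_simps flip: c_def)
  qed
qed

lemma norm_cinner_vdiff_le:
  assumes "x \<in> A" "y \<in> A" "z \<in> A"
  shows "norm (cinner V x (vdiff y z)) \<le> sqrt (Re (cinner V x x)) * vdist V y z"
  using cauchy_schwarz[OF assms(1) vdiff_in[OF assms(2,3)]]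
  by (metis Let_def norm_ge_zero real_le_rsqrt real_sqrt_mult vdist_def)

text \<open>By Cauchy-Schwarz the inner product is continuous in its second argument. Two
  approximating families are allowed so that the lemma covers both density of a domain and
  convergence in a graph.\<close>

lemma cinner_eq_limit:
  assumes A: "x \<in> A" "x' \<in> A" "y \<in> A" "y' \<in> A" "\<And>s. s \<in> S \<Longrightarrow> f s \<in> A \<and> g s \<in> A"
    and approx: "\<And>e. e > 0 \<Longrightarrow> \<exists>s\<in>S. vdist V y (f s) < e \<and> vdist V y' (g s) < e"
    and eq: "\<And>s. s \<in> S \<Longrightarrow> cinner V x (f s) = cinner V x' (g s)"
  shows "cinner V x y = cinner V x' y'"
proof -
  define K where "K = sqrt (Re (cinner V x x)) + sqrt (Re (cinner V x' x'))"
  have K: "0 \<le> K"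
    using A(1,2) by (simp add: K_def cinner_nonneg)
  have bound: "norm (cinner V x y - cinner V x' y') \<le> K * e" if "e > 0" for e
  proof -
    obtain s where s: "s \<in> S" "vdist V y (f s) < e" "vdist V y' (g s) < e"
      using approx[OF \<open>e > 0\<close>] by blast
    have "cinner V x y - cinner V x' y' =
        cinner V x (vdiff y (f s)) - cinner V x' (vdiff y' (g s))"
      using A s(1) eq[OF s(1)] by (simp add: cinner_linear)
    also have "norm \<dots> \<le> sqrt (Re (cinner V x x)) * vdist V y (f s) +
        sqrt (Re (cinner V x' x')) * vdist V y' (g s)"
      using A s(1) by (intro order_trans[OF norm_triangle_ineq4] add_mono norm_cinner_vdiff_le) auto
    also have "\<dots> \<le> K * e"
      using A s cinner_nonneg unfolding K_def distrib_right
      by (intro add_mono mult_left_mono) auto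
    finally show ?thesis .
  qed
  have "norm (cinner V x y - cinner V x' y') \<le> 0"
  proof (rule field_le_epsilon)
    fix e :: real
    assume "e > 0"
    \<comment> \<open>Dividing by \<open>K + 1\<close> instead of \<open>K\<close> keeps the
      argument valid for \<open>K = 0\<close>.\<close>
    then have "norm (cinner V x y - cinner V x' y') \<le> K * (e / (K + 1))"
      using K by (intro bound) simp
    also have "\<dots> \<le> e"
      using K \<open>e > 0\<close> by (simp add: field_simps)
    finally show "norm (cinner V x y - cinner V x' y') \<le> 0 + e"
      by simp
  qed
  then show ?thesis
    by simp
qed


section \<open>Adjoints and closures\<close>

text \<open>The equality extends from \<open>D\<close> to the carrier by continuity. This is the
  uniqueness behind the definite descriptions in \<open>adjoint_op\<close> and
  \<open>closure_op\<close>.\<close>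

lemma dense_cinner_eqD:
  assumes D: "dense_in V D" and x: "x \<in> carrier V" and y: "y \<in> carrier V"
    and eq: "\<And>w. w \<in> D \<Longrightarrow> cinner V x w = cinner V y w"
  shows "x = y"
proof -
  have A: "x \<in> A" "y \<in> A"
    using x y carrier_subset by auto
  have "cinner V x z = cinner V y z" if "z \<in> carrier V" for z
  proof (rule cinner_eq_limit[where f = id and g = id and S = D])
    show "\<exists>s\<in>D. vdist V z (id s) < e \<and> vdist V z (id s) < e" if "e > 0" for e
      using D \<open>z \<in> carrier V\<close> \<open>e > 0\<close> by (auto simp: dense_in_def closure_in_def)
    show "id s \<in> A \<and> id s \<in> A" if "s \<in> D" for s
      using that D carrier_subset by (auto simp: dense_in_def)
  qed (use A that carrier_subset eq in auto)
  \<comment> \<open>The difference of \<open>x\<close> and \<open>y\<close> is only known to lie in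
    \<open>A\<close>, not in the carrier. Testing with \<open>x\<close> and with \<open>y\<close>
    separately still shows that its norm is zero.\<close>
  from this[OF x] this[OF y] show ?thesis
    using A by (intro definite) (simp_all add: cinner_linear)
qed

lemma adjoint_op_eqI:
  assumes "dense_in V D" "z \<in> carrier V" "\<And>x. x \<in> D \<Longrightarrow> cinner V y (T x) = cinner V z x"
  shows "adjoint_op V T D y = z"
  unfolding adjoint_op_def using assms
  by (intro the_equality) (auto intro!: dense_cinner_eqD[OF assms(1)])

text \<open>Since \<open>x\<close> is in the adjoint domain, some \<open>z\<close> represents it
  there; by density \<open>z\<close> is the value of the adjoint, which is
  \<open>T x\<close>.\<close>

lemma self_adjoint_symmetric:
  assumes sa: "self_adjoint V T D" and x: "x \<in> D" and y: "y \<in> D"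
  shows "cinner V x (T y) = cinner V (T x) y"
proof -
  have "x \<in> adjoint_dom V T D"
    using sa x by (simp add: self_adjoint_def)
  then obtain z where z: "z \<in> carrier V" "\<And>w. w \<in> D \<Longrightarrow> cinner V x (T w) = cinner V z w"
    by (auto simp: adjoint_dom_def)
  have "T x = z"
    using sa x adjoint_op_eqI[where D = D and T = T, OF _ z] by (simp add: self_adjoint_def)
  then show ?thesis
    using z(2) y by simp
qed

text \<open>This is the inclusion of the adjoint in \<open>T\<close>; it serves to prove that a
  vector belongs to a self-adjoint domain and to compute its image at once.\<close>

lemma self_adjoint_maximal:
  assumes sa: "self_adjoint V T D" and y: "y \<in> carrier V" and z: "z \<in> carrier V"
    and eq: "\<And>x. x \<in> D \<Longrightarrow> cinner V y (T x) = cinner V z x"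
  shows "y \<in> D \<and> T y = z"
proof -
  have "y \<in> adjoint_dom V T D"
    using y z eq by (auto simp: adjoint_dom_def)
  moreover have "adjoint_op V T D y = z"
    using sa z eq by (intro adjoint_op_eqI) (auto simp: self_adjoint_def)
  ultimately show ?thesis
    using sa by (auto simp: self_adjoint_def)
qed

text \<open>An adjoint relation on \<open>D\<close> passes to limits in the graph: taking the
  closure of an operator does not change its adjoint.\<close>

lemma cinner_graph_closure:
  assumes T: "D \<subseteq> carrier V" "T ` D \<subseteq> carrier V" and uv: "(u, v) \<in> graph_closure V T D"
    and y: "y \<in> carrier V" and z: "z \<in> carrier V"
    and eq: "\<And>x. x \<in> D \<Longrightarrow> cinner V y (T x) = cinner V z x"
  shows "cinner V y v = cinner V z u"
proof (rule cinner_eq_limit[where f = T and g = id and S = D])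
  show "T s \<in> A \<and> id s \<in> A" if "s \<in> D" for s
    using T that carrier_subset by auto
  show "\<exists>s\<in>D. vdist V v (T s) < e \<and> vdist V u (id s) < e" if "e > 0" for e
    using uv that by (auto simp: graph_closure_def)
qed (use y z uv eq carrier_subset in \<open>auto simp: graph_closure_def\<close>)

section \<open>Closures of symmetric operators\<close>

lemma symmetric_operatorD:
  assumes "symmetric_operator V T D"
  shows "D \<subseteq> carrier V" "T ` D \<subseteq> carrier V" "dense_in V D"
    and "\<And>x y. x \<in> D \<Longrightarrow> y \<in> D \<Longrightarrow> cinner V x (T y) = cinner V (T x) y"
  using assms by (auto simp: symmetric_operator_def linear_operator_def linear_subspace_def)

text \<open>Symmetric operators are closable: the inner products of a limit value with the vectors
  of the dense set \<open>D\<close> are determined by \<open>u\<close> alone.\<close>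

lemma closure_op_eqI:
  assumes sym: "symmetric_operator V T D" and uv: "(u, v) \<in> graph_closure V T D"
  shows "closure_op V T D u = v"
  unfolding closure_op_def
proof (rule the_equality[where P = "\<lambda>z. (u, z) \<in> graph_closure V T D", OF uv])
  note T = symmetric_operatorD[OF sym]
  have test: "cinner V x w = cinner V (T x) u" if "(u, w) \<in> graph_closure V T D" "x \<in> D" for w x
    by (rule cinner_graph_closure[OF T(1,2) that(1)]) (use T that in auto)
  fix w
  assume w: "(u, w) \<in> graph_closure V T D"
  have in_carrier: "v \<in> carrier V" "w \<in> carrier V"
    using uv w by (auto simp: graph_closure_def)
  show "w = v"
  proof (rule dense_cinner_eqD[OF T(3) in_carrier(2,1)])
    fix x
    assume x: "x \<in> D"
    then have "cinner V x w = cinner V x v"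
      using test[OF w x] test[OF uv x] by simp
    then show "cinner V w x = cinner V v x"
      using T(1) x in_carrier carrier_subset cinner_commute[of x v] cinner_commute[of x w]
        by (simp add: subset_iff)
  qed
qed

lemma closure_op_in_graph_closure:
  assumes "symmetric_operator V T D" "u \<in> closure_dom V T D"
  shows "(u, closure_op V T D u) \<in> graph_closure V T D"
proof -
  obtain v where v: "(u, v) \<in> graph_closure V T D"
    using assms(2) by (auto simp: closure_dom_def)
  then show ?thesis
    using closure_op_eqI[OF assms(1) v] by simp
qed

lemma vdist_self: "x \<in> A \<Longrightarrow> vdist V x x = 0"
  by (simp add: vdist_def vdiff_self cinner_zero_left vzero_in)

lemma graph_subset_graph_closure:
  assumes "symmetric_operator V T D" "x \<in> D"
  shows "(x, T x) \<in> graph_closure V T D"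
proof -
  have "x \<in> carrier V" "T x \<in> carrier V"
    using symmetric_operatorD(1,2)[OF assms(1)] assms(2) by auto
  then show ?thesis
    using assms(2) carrier_subset vdist_self
    by (auto simp: graph_closure_def subset_iff intro!: bexI[of _ x])
qed

text \<open>The relation extends from \<open>D\<close> to the domain of the closure, and the
  closure, being self-adjoint, has no proper extension by such a pair.\<close>

lemma essentially_self_adjoint_adjoint:
  assumes esa: "essentially_self_adjoint V T D" and y: "y \<in> carrier V" and z: "z \<in> carrier V"
    and eq: "\<And>x. x \<in> D \<Longrightarrow> cinner V y (T x) = cinner V z x"
  shows "y \<in> closure_dom V T D \<and> closure_op V T D y = z"
proof -
  have sym: "symmetric_operator V T D"
    and sa: "self_adjoint V (closure_op V T D) (closure_dom V T D)"
    using esa by (simp_all add: essentially_self_adjoint_def)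
  show ?thesis
  proof (rule self_adjoint_maximal[OF sa y z])
    fix x
    assume "x \<in> closure_dom V T D"
    then have "(x, closure_op V T D x) \<in> graph_closure V T D"
      by (rule closure_op_in_graph_closure[OF sym])
    then show "cinner V y (closure_op V T D x) = cinner V z x"
      by (rule cinner_graph_closure[OF symmetric_operatorD(1,2)[OF sym] _ y z eq])
  qed
qed

text \<open>Any self-adjoint extension \<open>T'\<close> is symmetric against \<open>D\<close>,
  hence contained in the closure. Then the symmetry of the closure, tested on \<open>D'\<close>,
  puts the closure inside the adjoint of \<open>T'\<close>, which is \<open>T'\<close>
  itself.\<close>

lemma unique_self_adjoint_extension_closure:
  assumes esa: "essentially_self_adjoint V T D"
  shows "unique_self_adjoint_extension V T D (closure_op V T D) (closure_dom V T D)"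
  unfolding unique_self_adjoint_extension_def
proof (intro conjI allI impI)
  have sym: "symmetric_operator V T D"
    and sa: "self_adjoint V (closure_op V T D) (closure_dom V T D)"
    using esa by (simp_all add: essentially_self_adjoint_def)
  show "self_adjoint_extension V T D (closure_op V T D) (closure_dom V T D)"
    unfolding self_adjoint_extension_def
  proof (intro conjI subsetI ballI sa)
    fix x
    assume "x \<in> D"
    then have x: "(x, T x) \<in> graph_closure V T D"
      by (rule graph_subset_graph_closure[OF sym])
    then show "x \<in> closure_dom V T D"
      by (auto simp: closure_dom_def)
    show "closure_op V T D x = T x"
      by (rule closure_op_eqI[OF sym x])
  qed
  fix T' D'
  assume ext: "self_adjoint_extension V T D T' D'"
  then have sa': "self_adjoint V T' D'" and D': "D \<subseteq> D'" "\<And>x. x \<in> D \<Longrightarrow> T' x = T x"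
    by (auto simp: self_adjoint_extension_def)
  have carrier: "D' \<subseteq> carrier V" "T' ` D' \<subseteq> carrier V"
    "closure_dom V T D \<subseteq> carrier V" "closure_op V T D ` closure_dom V T D \<subseteq> carrier V"
    using sa sa' by (auto simp: self_adjoint_def linear_operator_def linear_subspace_def)
  have sub: "y \<in> closure_dom V T D \<and> closure_op V T D y = T' y" if "y \<in> D'" for y
  proof (rule essentially_self_adjoint_adjoint[OF esa])
    show "cinner V y (T x) = cinner V (T' y) x" if "x \<in> D" for x
      using self_adjoint_symmetric[OF sa' \<open>y \<in> D'\<close>, of x] that D' by auto
  qed (use that carrier in auto)
  have sup: "y \<in> D' \<and> T' y = closure_op V T D y" if "y \<in> closure_dom V T D" for y
  proof (rule self_adjoint_maximal[OF sa'])
    show "cinner V y (T' x) = cinner V (closure_op V T D y) x" if "x \<in> D'" for x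
      using self_adjoint_symmetric[OF sa \<open>y \<in> closure_dom V T D\<close>, of x] sub[OF that] by simp
  qed (use that carrier in auto)
  show "D' = closure_dom V T D" "\<forall>x\<in>closure_dom V T D. T' x = closure_op V T D x"
    using sub sup by blast+
qed

end


section \<open>Decoupling in a direct sum\<close>

text \<open>All axioms hold componentwise except definiteness, where a vanishing sum of nonnegative
  terms forces each term to vanish.\<close>

lemma inner_space_within_direct_sum:
  assumes "finite I" and V: "\<And>i. i \<in> I \<Longrightarrow> inner_space_within (V i) (A i)"
  shows "inner_space_within (direct_sum I V) (\<Pi>\<^sub>E i\<in>I. A i)"
proof
  show "carrier (direct_sum I V) \<subseteq> (\<Pi>\<^sub>E i\<in>I. A i)"
    using inner_space_within.carrier_subset[OF V] by (auto simp: direct_sum_def PiE_iff)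
  show "vzero (direct_sum I V) \<in> (\<Pi>\<^sub>E i\<in>I. A i)"
    using inner_space_within.vzero_in[OF V] by (auto simp: direct_sum_def)
  show "vadd (direct_sum I V) x y \<in> (\<Pi>\<^sub>E i\<in>I. A i)"
    if "x \<in> (\<Pi>\<^sub>E i\<in>I. A i)" "y \<in> (\<Pi>\<^sub>E i\<in>I. A i)" for x y
    using inner_space_within.vadd_in[OF V] that by (auto simp: direct_sum_def PiE_iff)
  show "vscale (direct_sum I V) a x \<in> (\<Pi>\<^sub>E i\<in>I. A i)"
    if "x \<in> (\<Pi>\<^sub>E i\<in>I. A i)" for a x
    using inner_space_within.vscale_in[OF V] that by (auto simp: direct_sum_def PiE_iff)
  show "cinner (direct_sum I V) x (vzero (direct_sum I V)) = 0"
    if "x \<in> (\<Pi>\<^sub>E i\<in>I. A i)" for x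
    using inner_space_within.cinner_zero_right[OF V] that
    by (auto simp: direct_sum_def PiE_iff intro!: sum.neutral)
  show "cinner (direct_sum I V) x (vadd (direct_sum I V) y z) =
      cinner (direct_sum I V) x y + cinner (direct_sum I V) x z"
    if "x \<in> (\<Pi>\<^sub>E i\<in>I. A i)" "y \<in> (\<Pi>\<^sub>E i\<in>I. A i)" "z \<in> (\<Pi>\<^sub>E i\<in>I. A i)" for x y z
    using inner_space_within.cinner_add_right[OF V] that
    by (auto simp: direct_sum_def PiE_iff simp flip: sum.distrib intro!: sum.cong)
  show "cinner (direct_sum I V) x (vscale (direct_sum I V) a y) = a * cinner (direct_sum I V) x y"
    if "x \<in> (\<Pi>\<^sub>E i\<in>I. A i)" "y \<in> (\<Pi>\<^sub>E i\<in>I. A i)" for a x y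
    using inner_space_within.cinner_scale_right[OF V] that
    by (auto simp: direct_sum_def PiE_iff sum_distrib_left intro!: sum.cong)
  show "cinner (direct_sum I V) y x = cnj (cinner (direct_sum I V) x y)"
    if "x \<in> (\<Pi>\<^sub>E i\<in>I. A i)" "y \<in> (\<Pi>\<^sub>E i\<in>I. A i)" for x y
    unfolding direct_sum_def inner_space.simps cnj_sum
    using that by (intro sum.cong refl inner_space_within.cinner_commute[OF V]) auto
  show "0 \<le> Re (cinner (direct_sum I V) x x)" if "x \<in> (\<Pi>\<^sub>E i\<in>I. A i)" for x
    using inner_space_within.cinner_nonneg[OF V] that
    by (auto simp: direct_sum_def PiE_iff Re_sum intro!: sum_nonneg)
  show "x = y"
    if x: "x \<in> (\<Pi>\<^sub>E i\<in>I. A i)" and y: "y \<in> (\<Pi>\<^sub>E i\<in>I. A i)" and zero: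
      "cinner (direct_sum I V)
        (vadd (direct_sum I V) x (vscale (direct_sum I V) (-1) y))
        (vadd (direct_sum I V) x (vscale (direct_sum I V) (-1) y)) = 0" for x y
  proof (rule PiE_ext[OF x y])
    fix i
    assume i: "i \<in> I"
    define d where "d j = vadd (V j) (x j) (vscale (V j) (-1) (y j))" for j
    have d: "d j \<in> A j" if "j \<in> I" for j
      using x y that V by (auto simp: d_def PiE_iff inner_space_within.vdiff_in)
    have "(\<Sum>j\<in>I. Re (cinner (V j) (d j) (d j))) = 0"
      using zero by (simp add: direct_sum_def d_def flip: Re_sum)
    then have "Re (cinner (V i) (d i) (d i)) = 0"
      using i \<open>finite I\<close> inner_space_within.cinner_nonneg[OF V d] by (simp add: sum_nonneg_eq_0_iff)
    moreover have "Im (cinner (V i) (d i) (d i)) = 0"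
      using inner_space_within.cinner_commute[OF V[OF i] d[OF i] d[OF i]]
      by (metis Reals_cnj_iff complex_is_Real_iff)
    ultimately show "x i = y i"
      using inner_space_within.definite[OF V[OF i], of "x i" "y i"] x y i
      by (auto simp: d_def complex_eq_iff)
  qed
qed

text \<open>The decoupling uses only the orthogonal sum, so it is stated for a finite index set
  \<open>J\<close> and one further index \<open>k\<close>; sectors of Fock space enter later, as an
  instance.\<close>

proposition top_summand_decouples:
  fixes V :: "'i \<Rightarrow> 'v inner_space"
  defines "F J \<equiv> direct_sum J V"
  assumes "finite J" and k: "k \<notin> J"
    and V: "\<And>i. i \<in> insert k J \<Longrightarrow> inner_space_within (V i) (A i)"
    and esa: "essentially_self_adjoint (V k) Ht Dt"
    and D0: "D0 = {(vzero (F J))(k := \<phi>) | \<phi>. \<phi> \<in> Dt}"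
    and H0: "\<And>\<phi>. \<phi> \<in> Dt \<Longrightarrow> H0 ((vzero (F J))(k := \<phi>)) = (vzero (F J))(k := Ht \<phi>)"
    and ext: "self_adjoint_extension (F (insert k J)) H0 D0 H D"
  shows "\<exists>H_below D_below H_top D_top.
           linear_operator (F J) H_below D_below \<and>
           linear_operator (V k) H_top D_top \<and>
           D = {\<psi>\<^sub>a(k := \<psi>\<^sub>b) | \<psi>\<^sub>a \<psi>\<^sub>b. \<psi>\<^sub>a \<in> D_below \<and> \<psi>\<^sub>b \<in> D_top} \<and>
           (\<forall>\<psi>\<^sub>a\<in>D_below. \<forall>\<psi>\<^sub>b\<in>D_top. H (\<psi>\<^sub>a(k := \<psi>\<^sub>b)) = (H_below \<psi>\<^sub>a)(k := H_top \<psi>\<^sub>b)) \<and>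
           unique_self_adjoint_extension (V k) Ht Dt H_top D_top"
proof -
  let ?W = "V k" and ?F = "F (insert k J)"
  define T where "T = closure_op ?W Ht Dt"
  define DT where "DT = closure_dom ?W Ht Dt"
  define up where "up \<phi> = (vzero (F J))(k := \<phi>)" for \<phi>
  \<comment> \<open>\<open>low\<close> embeds the lower sum by a zero top component, as
    \<open>up\<close> embeds the summand \<open>k\<close> by zeros below.\<close>
  define low where "low \<psi> = \<psi>(k := vzero ?W)" for \<psi> :: "'i \<Rightarrow> 'v"
  \<comment> \<open>Membership in \<open>extensional J\<close> fixes the value at \<open>k\<close>,
    which \<open>low\<close> overwrites, and so makes the lower vector unique.\<close>
  define DB where "DB = {\<psi> \<in> extensional J. low \<psi> \<in> D}"
  \<comment> \<open>Restricting to \<open>J\<close> drops the component at \<open>k\<close>, which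
    will turn out to be zero for vectors of \<open>DB\<close> (\<open>H_low_k\<close>).\<close>
  define HB where "HB \<psi> = restrict (H (low \<psi>)) J" for \<psi>

  interpret W: inner_space_within ?W "A k"
    by (rule V) simp
  interpret F: inner_space_within ?F "\<Pi>\<^sub>E i\<in>insert k J. A i"
    unfolding F_def using \<open>finite J\<close> V by (intro inner_space_within_direct_sum) auto

  \<comment> \<open>Membership and linearity facts for \<open>H\<close> and the closure
    \<open>T\<close>\<close>
  have saH: "self_adjoint ?F H D" and D0_sub: "D0 \<subseteq> D" and H_D0: "\<And>x. x \<in> D0 \<Longrightarrow> H x = H0 x"
    using ext by (auto simp: self_adjoint_extension_def)
  have linH: "linear_operator ?F H D"
    using saH by (simp add: self_adjoint_def)
  have D_carrier: "\<And>\<psi>. \<psi> \<in> D \<Longrightarrow> \<psi> \<in> carrier ?F" and H_carrier: "\<And>\<psi>. \<psi> \<in> D \<Longrightarrow> H \<psi> \<in> carrier ?F"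
    and D_add: "\<And>x y. x \<in> D \<Longrightarrow> y \<in> D \<Longrightarrow> vadd ?F x y \<in> D"
    and D_scale: "\<And>a x. x \<in> D \<Longrightarrow> vscale ?F a x \<in> D"
    and D_zero: "vzero ?F \<in> D"
    and H_add: "\<And>x y. x \<in> D \<Longrightarrow> y \<in> D \<Longrightarrow> H (vadd ?F x y) = vadd ?F (H x) (H y)"
    and H_scale: "\<And>a x. x \<in> D \<Longrightarrow> H (vscale ?F a x) = vscale ?F a (H x)"
    using linH by (auto simp: linear_operator_def linear_subspace_def)
  have carrier_comp: "\<psi> i \<in> carrier (V i)" if "\<psi> \<in> carrier ?F" "i \<in> insert k J" for \<psi> i
    using that by (auto simp: F_def direct_sum_def)
  have carrier_A: "\<psi> i \<in> A i" if "\<psi> \<in> carrier ?F" "i \<in> insert k J" for \<psi> i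
    using carrier_comp[OF that] inner_space_within.carrier_subset[OF V[OF that(2)]] by auto
  have ext_undef: "\<psi> i = undefined" if "\<psi> \<in> carrier ?F" "i \<notin> insert k J" for \<psi> i
    using that by (auto simp: F_def direct_sum_def PiE_iff extensional_def)
  have sym: "symmetric_operator ?W Ht Dt" and saT: "self_adjoint ?W T DT"
    using esa by (simp_all add: essentially_self_adjoint_def T_def DT_def)
  have linT: "linear_operator ?W T DT"
    using saT by (simp add: self_adjoint_def)
  have DT_carrier: "\<And>\<xi>. \<xi> \<in> DT \<Longrightarrow> \<xi> \<in> carrier ?W" and T_carrier: "\<And>\<xi>. \<xi> \<in> DT \<Longrightarrow> T \<xi> \<in> carrier ?W"
    and DT_zero: "vzero ?W \<in> DT"
    using linT by (auto simp: linear_operator_def linear_subspace_def)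
  \<comment> \<open>The locale places zero only in \<open>A i\<close>. That it lies in the carrier
    is read off from the zero vector of the sum, which belongs to the subspace
    \<open>D\<close>.\<close>
  have zero_carrier: "vzero (V i) \<in> carrier (V i)" if "i \<in> insert k J" for i
    using carrier_comp[OF D_carrier[OF D_zero] that] that by (simp add: F_def direct_sum_def split: if_splits)
  have up_carrier: "up \<xi> \<in> carrier ?F" if "\<xi> \<in> carrier ?W" for \<xi>
    using that zero_carrier k by (auto simp: up_def F_def direct_sum_def PiE_iff extensional_def)
  have low_k: "low \<psi> k = vzero ?W" for \<psi>
    by (simp add: low_def)

  have cinner_up_left: "cinner ?F (up \<xi>) \<eta> = cinner ?W \<xi> (\<eta> k)" if "\<eta> \<in> carrier ?F" for \<xi> \<eta>
  proof -
    have "(\<Sum>i\<in>J. cinner (V i) (up \<xi> i) (\<eta> i)) = 0"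
      using k carrier_A[OF that] inner_space_within.cinner_zero_left[OF V]
      by (intro sum.neutral) (auto simp: up_def F_def direct_sum_def)
    then show ?thesis
      using \<open>finite J\<close> k by (simp add: F_def direct_sum_def) (simp add: up_def)
  qed
  have cinner_up_right: "cinner ?F \<eta> (up \<xi>) = cinner ?W (\<eta> k) \<xi>" if "\<eta> \<in> carrier ?F" for \<xi> \<eta>
  proof -
    have "(\<Sum>i\<in>J. cinner (V i) (\<eta> i) (up \<xi> i)) = 0"
      using k carrier_A[OF that] inner_space_within.cinner_zero_right[OF V]
      by (intro sum.neutral) (auto simp: up_def F_def direct_sum_def)
    then show ?thesis
      using \<open>finite J\<close> k by (simp add: F_def direct_sum_def) (simp add: up_def)
  qed

  \<comment> \<open>The closure as the top block of \<open>H\<close>\<close>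
  have D0': "up \<phi> \<in> D" "H (up \<phi>) = up (Ht \<phi>)" if "\<phi> \<in> Dt" for \<phi>
  proof -
    have "up \<phi> \<in> D0"
      using that D0 by (auto simp: up_def)
    then show "up \<phi> \<in> D" "H (up \<phi>) = up (Ht \<phi>)"
      using D0_sub H_D0 H0[OF that] by (auto simp: up_def)
  qed
  have top: "\<psi> k \<in> DT \<and> T (\<psi> k) = H \<psi> k" if \<psi>: "\<psi> \<in> D" for \<psi>
    unfolding T_def DT_def
  proof (rule W.essentially_self_adjoint_adjoint[OF esa])
    show "\<psi> k \<in> carrier ?W" "H \<psi> k \<in> carrier ?W"
      using carrier_comp D_carrier[OF \<psi>] H_carrier[OF \<psi>] by auto
    show "cinner ?W (\<psi> k) (Ht \<phi>) = cinner ?W (H \<psi> k) \<phi>" if "\<phi> \<in> Dt" for \<phi>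
      using F.self_adjoint_symmetric[OF saH \<psi> D0'(1)[OF that]]
        D0'(2)[OF that] D_carrier[OF \<psi>] H_carrier[OF \<psi>]
      by (simp add: cinner_up_right)
  qed
  have up_D: "up \<xi> \<in> D \<and> H (up \<xi>) = up (T \<xi>)" if \<xi>: "\<xi> \<in> DT" for \<xi>
  proof (rule F.self_adjoint_maximal[OF saH])
    show "up \<xi> \<in> carrier ?F" "up (T \<xi>) \<in> carrier ?F"
      using up_carrier DT_carrier[OF \<xi>] T_carrier[OF \<xi>] by auto
    show "cinner ?F (up \<xi>) (H \<eta>) = cinner ?F (up (T \<xi>)) \<eta>" if "\<eta> \<in> D" for \<eta>
      using top[OF that] W.self_adjoint_symmetric[OF saT \<xi>, of "\<eta> k"]
        D_carrier[OF that] H_carrier[OF that]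
      by (simp add: cinner_up_left)
  qed

  \<comment> \<open>Removing the top component amounts to subtracting a vector which
    \<open>up_D\<close> puts in \<open>D\<close>; hence the lower part of a vector of
    \<open>D\<close> is again in \<open>D\<close>.\<close>
  have split: "low (restrict \<psi> J) = vadd ?F \<psi> (vscale ?F (-1) (up (\<psi> k)))" if \<psi>: "\<psi> \<in> D" for \<psi>
  proof
    fix i
    consider "i = k" | "i \<in> J" "i \<noteq> k" | "i \<notin> insert k J"
      using k by blast
    then show "low (restrict \<psi> J) i = vadd ?F \<psi> (vscale ?F (-1) (up (\<psi> k))) i"
    proof cases
      case 1
      then show ?thesis
        using carrier_A[OF D_carrier[OF \<psi>], of k]
        by (simp add: low_def up_def F_def direct_sum_def W.vdiff_self)
    next
      case 2
      then interpret Vi: inner_space_within "V i" "A i"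
        by (intro V) simp
      show ?thesis
        using 2 carrier_A[OF D_carrier[OF \<psi>], of i]
        by (simp add: low_def up_def F_def direct_sum_def Vi.vscale_vzero Vi.vadd_zero_right)
    next
      case 3
      then show ?thesis
        by (auto simp: low_def F_def direct_sum_def)
    qed
  qed
  have restrict_DB: "restrict \<psi> J \<in> DB" if \<psi>: "\<psi> \<in> D" for \<psi>
    using split[OF \<psi>] D_add[OF \<psi> D_scale] up_D top[OF \<psi>] by (auto simp: DB_def)
  have join: "\<psi>(k := \<xi>) = vadd ?F (low \<psi>) (up \<xi>)" if \<psi>: "\<psi> \<in> DB" and \<xi>: "\<xi> \<in> DT" for \<psi> \<xi>
  proof
    have lowD: "low \<psi> \<in> D" and ext_J: "\<psi> \<in> extensional J"
      using \<psi> by (auto simp: DB_def)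
    fix i
    consider "i = k" | "i \<in> J" "i \<noteq> k" | "i \<notin> insert k J"
      using k by blast
    then show "(\<psi>(k := \<xi>)) i = vadd ?F (low \<psi>) (up \<xi>) i"
    proof cases
      case 1
      then show ?thesis
        using DT_carrier[OF \<xi>] W.carrier_subset
        by (auto simp: low_def up_def F_def direct_sum_def W.vadd_zero_left)
    next
      case 2
      then interpret Vi: inner_space_within "V i" "A i"
        by (intro V) simp
      show ?thesis
        using 2 carrier_A[OF D_carrier[OF lowD], of i]
        by (simp add: low_def up_def F_def direct_sum_def Vi.vadd_zero_right)
    next
      case 3
      then show ?thesis
        using ext_J by (auto simp: F_def direct_sum_def extensional_def)
    qed
  qed
  have H_join: "H (\<psi>(k := \<xi>)) = (HB \<psi>)(k := T \<xi>)" if \<psi>: "\<psi> \<in> DB" and \<xi>: "\<xi> \<in> DT" for \<psi> \<xi>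
  proof
    have lowD: "low \<psi> \<in> D"
      using \<psi> by (auto simp: DB_def)
    have T0: "T (vzero ?W) = vzero ?W"
    proof -
      have "T (vzero ?W) = T (vscale ?W 0 (vzero ?W))"
        by (simp add: W.vscale_vzero)
      also have "\<dots> = vscale ?W 0 (T (vzero ?W))"
        using linT DT_zero by (simp add: linear_operator_def)
      also have "\<dots> = vzero ?W"
        using T_carrier[OF DT_zero] W.carrier_subset
        by (intro W.cinner_eqI) (auto simp: W.cinner_linear)
      finally show ?thesis .
    qed
    \<comment> \<open>Nothing leaks from the lower summands into the top one: by \<open>top\<close>,
      the top component of the image is \<open>T\<close> applied to zero.\<close>
    have H_low_k: "H (low \<psi>) k = vzero ?W"
      using top[OF lowD] T0 by (simp add: low_k)
    have eq: "H (\<psi>(k := \<xi>)) = vadd ?F (H (low \<psi>)) (up (T \<xi>))"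
      using join[OF \<psi> \<xi>] H_add[OF lowD] up_D[OF \<xi>] by simp
    fix i
    consider "i = k" | "i \<in> J" "i \<noteq> k" | "i \<notin> insert k J"
      using k by blast
    then show "H (\<psi>(k := \<xi>)) i = ((HB \<psi>)(k := T \<xi>)) i"
    proof cases
      case 1
      then show ?thesis
        using T_carrier[OF \<xi>] W.carrier_subset H_low_k unfolding eq
        by (auto simp: up_def F_def direct_sum_def W.vadd_zero_left)
    next
      case 2
      then interpret Vi: inner_space_within "V i" "A i"
        by (intro V) simp
      show ?thesis
        using 2 carrier_A[OF H_carrier[OF lowD], of i] unfolding eq
        by (simp add: HB_def up_def F_def direct_sum_def Vi.vadd_zero_right)
    next
      case 3
      then show ?thesis
        unfolding eq by (auto simp: HB_def F_def direct_sum_def)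
    qed
  qed

  \<comment> \<open>Linearity of the lower block\<close>
  have low_add: "low (vadd (F J) x y) = vadd ?F (low x) (low y)" for x y
    using k by (auto simp: fun_eq_iff low_def F_def direct_sum_def W.vadd_zero_left W.vzero_in)
  have low_scale: "low (vscale (F J) a x) = vscale ?F a (low x)" for a x
    using k by (auto simp: fun_eq_iff low_def F_def direct_sum_def W.vscale_vzero)
  have low_zero: "low (vzero (F J)) = vzero ?F"
    using k by (auto simp: fun_eq_iff low_def F_def direct_sum_def)
  have linB: "linear_operator (F J) HB DB"
    unfolding linear_operator_def linear_subspace_def
  proof (intro conjI ballI allI)
    show "DB \<subseteq> carrier (F J)"
    proof
      fix \<psi>
      assume \<psi>: "\<psi> \<in> DB"
      have "\<psi> i \<in> carrier (V i)" if "i \<in> J" for i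
        using carrier_comp[OF D_carrier, of "low \<psi>" i] \<psi> that k by (auto simp: DB_def low_def split: if_splits)
      then show "\<psi> \<in> carrier (F J)"
        using \<psi> by (auto simp: F_def direct_sum_def DB_def PiE_iff)
    qed
    show "vzero (F J) \<in> DB"
      using D_zero by (auto simp: DB_def low_zero) (simp add: F_def direct_sum_def)
    show "vadd (F J) x y \<in> DB" if "x \<in> DB" "y \<in> DB" for x y
      using that D_add by (auto simp: DB_def low_add) (simp add: F_def direct_sum_def)
    show "vscale (F J) a x \<in> DB" if "x \<in> DB" for a x
      using that D_scale by (auto simp: DB_def low_scale) (simp add: F_def direct_sum_def)
    show "HB ` DB \<subseteq> carrier (F J)"
      using carrier_comp[OF H_carrier] by (auto simp: DB_def HB_def) (simp add: F_def direct_sum_def)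
    show "HB (vadd (F J) x y) = vadd (F J) (HB x) (HB y)" if "x \<in> DB" "y \<in> DB" for x y
      using that H_add by (auto simp: DB_def HB_def low_add fun_eq_iff) (auto simp: F_def direct_sum_def)
    show "HB (vscale (F J) a x) = vscale (F J) a (HB x)" if "x \<in> DB" for a x
      using that H_scale by (auto simp: DB_def HB_def low_scale fun_eq_iff) (auto simp: F_def direct_sum_def)
  qed
  have D_eq: "D = {\<psi>\<^sub>a(k := \<psi>\<^sub>b) | \<psi>\<^sub>a \<psi>\<^sub>b. \<psi>\<^sub>a \<in> DB \<and> \<psi>\<^sub>b \<in> DT}"
  proof (intro equalityI subsetI)
    fix \<psi>
    assume \<psi>: "\<psi> \<in> D"
    \<comment> \<open>Outside \<open>insert k J\<close> both sides are
      \<open>undefined\<close>.\<close>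
    then have "\<psi> = (restrict \<psi> J)(k := \<psi> k)"
      using ext_undef[OF D_carrier] by (auto simp: fun_eq_iff)
    then show "\<psi> \<in> {\<psi>\<^sub>a(k := \<psi>\<^sub>b) | \<psi>\<^sub>a \<psi>\<^sub>b. \<psi>\<^sub>a \<in> DB \<and> \<psi>\<^sub>b \<in> DT}"
      using restrict_DB[OF \<psi>] top[OF \<psi>] by blast
  next
    fix \<psi>
    assume "\<psi> \<in> {\<psi>\<^sub>a(k := \<psi>\<^sub>b) | \<psi>\<^sub>a \<psi>\<^sub>b. \<psi>\<^sub>a \<in> DB \<and> \<psi>\<^sub>b \<in> DT}"
    then show "\<psi> \<in> D"
      using join D_add up_D by (auto simp: DB_def)
  qed
  show ?thesis
    using linB linT D_eq H_join W.unique_self_adjoint_extension_closure[OF esa, folded T_def DT_def]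
    by blast
qed


section \<open>Square-integrable functions\<close>

lemma square_integrable_scale:
  fixes f :: "'a \<Rightarrow> complex"
  assumes "square_integrable M f"
  shows "square_integrable M (\<lambda>x. a * f x)"
  using assms by (auto simp: square_integrable_def norm_mult power_mult_distrib)

lemma square_integrable_add:
  fixes f g :: "'a \<Rightarrow> complex"
  assumes "square_integrable M f" "square_integrable M g"
  shows "square_integrable M (\<lambda>x. f x + g x)"
  unfolding square_integrable_def
proof
  have [measurable]: "f \<in> borel_measurable M" "g \<in> borel_measurable M"
    using assms by (simp_all add: square_integrable_def)
  show "(\<lambda>x. f x + g x) \<in> borel_measurable M"
    by simp
  show "integrable M (\<lambda>x. (norm (f x + g x))\<^sup>2)"
  proof (rule Bochner_Integration.integrable_bound)
    show "integrable M (\<lambda>x. 2 * (norm (f x))\<^sup>2 + 2 * (norm (g x))\<^sup>2)"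
      using assms by (simp add: square_integrable_def)
    have "(norm (f x + g x))\<^sup>2 \<le> 2 * (norm (f x))\<^sup>2 + 2 * (norm (g x))\<^sup>2" for x
    proof -
      have "(norm (f x + g x))\<^sup>2 \<le> (norm (f x) + norm (g x))\<^sup>2"
        by (intro power_mono norm_triangle_ineq) simp
      also have "\<dots> \<le> 2 * (norm (f x))\<^sup>2 + 2 * (norm (g x))\<^sup>2"
        using zero_le_power2[of "norm (f x) - norm (g x)"] by (simp add: power2_eq_square algebra_simps)
      finally show ?thesis .
    qed
    then show "AE x in M. norm ((norm (f x + g x))\<^sup>2) \<le>
        norm (2 * (norm (f x))\<^sup>2 + 2 * (norm (g x))\<^sup>2)"
      by simp
  qed simp
qed

lemma square_integrable_zero: "square_integrable M (\<lambda>x. 0 :: complex)"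
  by (simp add: square_integrable_def)

lemma square_integrable_sum:
  fixes f :: "'i \<Rightarrow> 'a \<Rightarrow> complex"
  assumes "\<And>i. i \<in> I \<Longrightarrow> square_integrable M (f i)"
  shows "square_integrable M (\<lambda>x. \<Sum>i\<in>I. f i x)"
  using assms
  by (induction I rule: infinite_finite_induct) (simp_all add: square_integrable_zero square_integrable_add)

text \<open>The product is dominated by the sum of the two squared moduli.\<close>

lemma integrable_cnj_mult:
  fixes f g :: "'a \<Rightarrow> complex"
  assumes "square_integrable M f" "square_integrable M g"
  shows "integrable M (\<lambda>x. cnj (f x) * g x)"
proof (rule Bochner_Integration.integrable_bound)
  have [measurable]: "f \<in> borel_measurable M" "g \<in> borel_measurable M"
    using assms by (simp_all add: square_integrable_def)
  have "(\<lambda>x. cnj (f x)) \<in> borel_measurable M"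
    by (rule borel_measurable_continuous_on[of cnj]) (auto intro!: continuous_intros)
  then show "(\<lambda>x. cnj (f x) * g x) \<in> borel_measurable M"
    by simp
  show "integrable M (\<lambda>x. (norm (f x))\<^sup>2 + (norm (g x))\<^sup>2)"
    using assms by (simp add: square_integrable_def)
  have "norm (f x) * norm (g x) \<le> (norm (f x))\<^sup>2 + (norm (g x))\<^sup>2" for x
    using sum_squares_bound[of "norm (f x)" "norm (g x)"]
      mult_nonneg_nonneg[OF norm_ge_zero[of "f x"] norm_ge_zero[of "g x"]]
    by linarith
  then show "AE x in M. norm (cnj (f x) * g x) \<le> norm ((norm (f x))\<^sup>2 + (norm (g x))\<^sup>2)"
    by (simp add: norm_mult)
qed

section \<open>Classes modulo null sets and their representatives\<close>

lemma equiv_ae_rel: "equiv {f. square_integrable M f} (ae_rel M)"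
proof (rule equivI)
  show "ae_rel M \<subseteq> {f. square_integrable M f} \<times> {f. square_integrable M f}"
    "refl_on {f. square_integrable M f} (ae_rel M)"
    by (auto simp: ae_rel_def refl_on_def)
  show "sym (ae_rel M)"
    by (auto simp: ae_rel_def sym_def eq_commute)
  show "trans (ae_rel M)"
    unfolding ae_rel_def trans_def by (fastforce elim: eventually_elim2)
qed

lemma carrier_L2: "carrier (L2 M) = ae_class M ` {f. square_integrable M f}"
  by (auto simp: L2_def quotient_def ae_class_def)

lemma ae_class_in_L2: "square_integrable M f \<Longrightarrow> ae_class M f \<in> carrier (L2 M)"
  by (simp add: carrier_L2)

lemma ae_class_eqI:
  assumes "square_integrable M f" "square_integrable M g" "AE x in M. f x = g x"
  shows "ae_class M f = ae_class M g"
  unfolding ae_class_def by (rule equiv_class_eq[OF equiv_ae_rel]) (use assms in \<open>simp add: ae_rel_def\<close>)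

lemma rep_ae_class:
  assumes "square_integrable M f"
  shows "square_integrable M (rep (ae_class M f))" "AE x in M. rep (ae_class M f) x = f x"
proof -
  have "f \<in> ae_class M f"
    using assms by (simp add: ae_class_def ae_rel_def)
  then have "rep (ae_class M f) \<in> ae_class M f"
    unfolding rep_def by (rule someI[where P = "\<lambda>g. g \<in> ae_class M f"])
  then show "square_integrable M (rep (ae_class M f))" "AE x in M. rep (ae_class M f) x = f x"
    by (auto simp: ae_class_def ae_rel_def)
qed

lemma square_integrable_rep: "F \<in> carrier (L2 M) \<Longrightarrow> square_integrable M (rep F)"
  by (auto simp: carrier_L2 rep_ae_class)

lemma ae_class_rep:
  assumes "F \<in> carrier (L2 M)"
  shows "ae_class M (rep F) = F"
proof -
  obtain f where f: "square_integrable M f" "F = ae_class M f"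
    using assms by (auto simp: carrier_L2)
  show ?thesis
    unfolding f(2) by (rule ae_class_eqI[OF rep_ae_class(1)[OF f(1)] f(1) rep_ae_class(2)[OF f(1)]])
qed

text \<open>The representative chosen by \<open>rep\<close> may be replaced by \<open>g\<close>, as
  both agree almost everywhere. This gives additivity and homogeneity in the second
  argument.\<close>

lemma cinner_L2_ae_class:
  assumes F: "F \<in> carrier (L2 M)" and g: "square_integrable M g"
  shows "cinner (L2 M) F (ae_class M g) = (LINT x|M. cnj (rep F x) * g x)"
proof -
  have "(LINT x|M. cnj (rep F x) * rep (ae_class M g) x) = (LINT x|M. cnj (rep F x) * g x)"
    using integrable_cnj_mult[OF square_integrable_rep[OF F] rep_ae_class(1)[OF g]]
      integrable_cnj_mult[OF square_integrable_rep[OF F] g] rep_ae_class(2)[OF g]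
    by (intro integral_cong_AE borel_measurable_integrable) auto
  then show ?thesis
    by (simp add: L2_def)
qed

lemma L2_simps:
  "vzero (L2 M) = ae_class M (\<lambda>x. 0)"
  "vadd (L2 M) F G = ae_class M (\<lambda>x. rep F x + rep G x)"
  "vscale (L2 M) a F = ae_class M (\<lambda>x. a * rep F x)"
  by (simp_all add: L2_def)

lemma cinner_L2: "cinner (L2 M) F G = (LINT x|M. cnj (rep F x) * rep G x)"
  by (simp add: L2_def)

lemma cinner_L2_self: "cinner (L2 M) F F = complex_of_real (LINT x|M. (norm (rep F x))\<^sup>2)"
proof -
  have "(\<lambda>x. cnj (rep F x) * rep F x) = (\<lambda>x. complex_of_real ((norm (rep F x))\<^sup>2))"
    unfolding complex_norm_square by (simp add: mult.commute)
  then show ?thesis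
    unfolding cinner_L2 by (simp only: integral_complex_of_real)
qed

lemma AE_zero_of_cinner_L2_zero:
  assumes F: "F \<in> carrier (L2 M)" and zero: "cinner (L2 M) F F = 0"
  shows "AE x in M. rep F x = 0"
proof -
  have int: "integrable M (\<lambda>x. (norm (rep F x))\<^sup>2)"
    using square_integrable_rep[OF F] by (simp add: square_integrable_def)
  have "(LINT x|M. (norm (rep F x))\<^sup>2) = 0"
    using zero unfolding cinner_L2_self of_real_eq_0_iff .
  then show ?thesis
    using integral_nonneg_eq_0_iff_AE[OF int] by simp
qed

lemma carrier_update_simps:
  "carrier (V\<lparr>carrier := S\<rparr>) = S" "vzero (V\<lparr>carrier := S\<rparr>) = vzero V"
  "vadd (V\<lparr>carrier := S\<rparr>) = vadd V" "vscale (V\<lparr>carrier := S\<rparr>) = vscale V"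
  "cinner (V\<lparr>carrier := S\<rparr>) = cinner V"
  by simp_all

text \<open>The operations are those of the full space, whatever the carrier \<open>S\<close>, so
  the axioms are verified on all square-integrable classes.\<close>

lemma inner_space_within_L2:
  assumes "S \<subseteq> carrier (L2 M)"
  shows "inner_space_within ((L2 M)\<lparr>carrier := S\<rparr>) (carrier (L2 M))"
proof (rule inner_space_within.intro, unfold carrier_update_simps)
  note rep = square_integrable_rep
  show "S \<subseteq> carrier (L2 M)"
    by (rule assms)
  show "vzero (L2 M) \<in> carrier (L2 M)"
    by (simp add: L2_simps ae_class_in_L2 square_integrable_zero)
  show add: "vadd (L2 M) F G \<in> carrier (L2 M)"
    if "F \<in> carrier (L2 M)" "G \<in> carrier (L2 M)" for F G
    using that by (simp add: L2_simps ae_class_in_L2 square_integrable_add rep)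
  show scale: "vscale (L2 M) a F \<in> carrier (L2 M)" if "F \<in> carrier (L2 M)" for a F
    using that by (simp add: L2_simps ae_class_in_L2 square_integrable_scale rep)
  show "cinner (L2 M) F (vzero (L2 M)) = 0" if "F \<in> carrier (L2 M)" for F
    using that by (simp add: L2_simps cinner_L2_ae_class square_integrable_zero)
  show "cinner (L2 M) F (vadd (L2 M) G K) = cinner (L2 M) F G + cinner (L2 M) F K"
    if F: "F \<in> carrier (L2 M)" and G: "G \<in> carrier (L2 M)" and K: "K \<in> carrier (L2 M)" for F G K
  proof -
    have "cinner (L2 M) F (vadd (L2 M) G K) = (LINT x|M. cnj (rep F x) * (rep G x + rep K x))"
      unfolding L2_simps by (intro cinner_L2_ae_class square_integrable_add rep F G K)
    also have "\<dots> = cinner (L2 M) F G + cinner (L2 M) F K"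
      unfolding cinner_L2 distrib_left
      by (intro Bochner_Integration.integral_add integrable_cnj_mult rep F G K)
    finally show ?thesis .
  qed
  show "cinner (L2 M) F (vscale (L2 M) a G) = a * cinner (L2 M) F G"
    if F: "F \<in> carrier (L2 M)" and G: "G \<in> carrier (L2 M)" for a F G
  proof -
    have "cinner (L2 M) F (vscale (L2 M) a G) = (LINT x|M. cnj (rep F x) * (a * rep G x))"
      unfolding L2_simps by (intro cinner_L2_ae_class square_integrable_scale rep F G)
    also have "\<dots> = a * cinner (L2 M) F G"
      unfolding cinner_L2 mult.left_commute[of _ a] by simp
    finally show ?thesis .
  qed
  show "cinner (L2 M) G F = cnj (cinner (L2 M) F G)" for F G
    unfolding cinner_L2 Bochner_Integration.integral_cnj[symmetric] by (simp add: mult.commute)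
  show "0 \<le> Re (cinner (L2 M) F F)" for F
    unfolding cinner_L2_self by simp
  show "F = G"
    if F: "F \<in> carrier (L2 M)" and G: "G \<in> carrier (L2 M)" and zero:
      "cinner (L2 M) (vadd (L2 M) F (vscale (L2 M) (-1) G)) (vadd (L2 M) F (vscale (L2 M) (-1) G)) = 0"
    for F G
  proof -
    define E where "E = vscale (L2 M) (-1) G"
    define K where "K = vadd (L2 M) F E"
    have E: "E \<in> carrier (L2 M)"
      unfolding E_def by (rule scale[OF G])
    have K: "K \<in> carrier (L2 M)"
      unfolding K_def by (rule add[OF F E])
    \<comment> \<open>Each operation chooses a new representative, which matches the pointwise
      formula only almost everywhere; three such identities are combined.\<close>
    have "AE x in M. rep K x = 0"
      using zero by (intro AE_zero_of_cinner_L2_zero K) (simp add: K_def E_def)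
    moreover have "AE x in M. rep E x = - 1 * rep G x"
      unfolding E_def L2_simps by (rule rep_ae_class(2)[OF square_integrable_scale[OF rep[OF G]]])
    moreover have "AE x in M. rep K x = rep F x + rep E x"
      unfolding K_def L2_simps by (rule rep_ae_class(2)[OF square_integrable_add[OF rep[OF F] rep[OF E]]])
    ultimately have "AE x in M. rep F x = rep G x"
      by eventually_elim simp
    then have "ae_class M (rep F) = ae_class M (rep G)"
      by (intro ae_class_eqI rep F G)
    then show ?thesis
      unfolding ae_class_rep[OF F] ae_class_rep[OF G] .
  qed
qed


section \<open>Sectors of Fock space\<close>

text \<open>A product measure is determined by its values on boxes. The preimage of a box is the box
  with permuted sides, and its measure is the same product in another order.\<close>

lemma (in product_sigma_finite) distr_PiM_permute:
  assumes "finite I" and p: "p permutes I" and M: "\<And>i. i \<in> I \<Longrightarrow> M (p i) = M i"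
  shows "(\<lambda>c. c \<circ> p) \<in> Pi\<^sub>M I M \<rightarrow>\<^sub>M Pi\<^sub>M I M"
    and "distr (Pi\<^sub>M I M) (Pi\<^sub>M I M) (\<lambda>c. c \<circ> p) = Pi\<^sub>M I M"
proof -
  have p_in: "p i \<in> I \<longleftrightarrow> i \<in> I" for i
    using permutes_in_image[OF p] .
  show meas: "(\<lambda>c. c \<circ> p) \<in> Pi\<^sub>M I M \<rightarrow>\<^sub>M Pi\<^sub>M I M"
  proof (rule measurable_PiM_single')
    show "(\<lambda>c. (c \<circ> p) i) \<in> Pi\<^sub>M I M \<rightarrow>\<^sub>M M i" if "i \<in> I" for i
      using measurable_component_singleton[of "p i" I M] that p_in M by simp
    show "(\<lambda>c i. (c \<circ> p) i) \<in> space (Pi\<^sub>M I M) \<rightarrow> (\<Pi>\<^sub>E i\<in>I. space (M i))"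
      \<comment> \<open>Since \<open>p\<close> fixes every index outside \<open>I\<close>, permuted
        configurations remain \<open>undefined\<close> there.\<close>
      using p_in M permutes_not_in[OF p]
      by (auto simp: space_PiM PiE_iff extensional_def) (metis)
  qed
  show "distr (Pi\<^sub>M I M) (Pi\<^sub>M I M) (\<lambda>c. c \<circ> p) = Pi\<^sub>M I M"
  proof (rule PiM_eqI[OF \<open>finite I\<close>])
    fix B
    assume B: "\<And>i. i \<in> I \<Longrightarrow> B i \<in> sets (M i)"
    have q: "inv p permutes I"
      by (rule permutes_inv[OF p])
    have q_in: "inv p i \<in> I \<longleftrightarrow> i \<in> I" for i
      using permutes_in_image[OF q] .
    have Mq: "M (inv p i) = M i" if "i \<in> I" for i
      using M[of "inv p i"] q_in that permutes_inverses(1)[OF p] by simp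
    have "(\<lambda>c. c \<circ> p) -` (\<Pi>\<^sub>E i\<in>I. B i) \<inter> space (Pi\<^sub>M I M) = (\<Pi>\<^sub>E i\<in>I. B (inv p i))"
    proof (intro equalityI subsetI)
      fix c
      assume c: "c \<in> (\<lambda>c. c \<circ> p) -` (\<Pi>\<^sub>E i\<in>I. B i) \<inter> space (Pi\<^sub>M I M)"
      have "c i \<in> B (inv p i)" if "i \<in> I" for i
      proof -
        have "(c \<circ> p) (inv p i) \<in> B (inv p i)"
          using c that q_in by (auto simp: PiE_iff)
        then show ?thesis
          by (simp add: permutes_inverses(1)[OF p])
      qed
      then show "c \<in> (\<Pi>\<^sub>E i\<in>I. B (inv p i))"
        using c by (auto simp: PiE_iff space_PiM)
    next
      fix c
      assume c: "c \<in> (\<Pi>\<^sub>E i\<in>I. B (inv p i))"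
      have "c (p i) \<in> B i" if "i \<in> I" for i
        using PiE_mem[OF c, of "p i"] that p_in by (simp add: permutes_inverses(2)[OF p])
      moreover have "c (p i) = undefined" if "i \<notin> I" for i
        using c that p_in by (auto simp: PiE_iff extensional_def)
      moreover have "c i \<in> space (M i)" if "i \<in> I" for i
        using PiE_mem[OF c that] sets.sets_into_space[OF B[of "inv p i"]] q_in Mq that by auto
      ultimately show "c \<in> (\<lambda>c. c \<circ> p) -` (\<Pi>\<^sub>E i\<in>I. B i) \<inter> space (Pi\<^sub>M I M)"
        using c by (auto simp: PiE_iff space_PiM extensional_def)
    qed
    moreover have "Pi\<^sub>E I B \<in> sets (Pi\<^sub>M I M)"
      using \<open>finite I\<close> B by (intro sets_PiM_I_finite) auto
    ultimately have "emeasure (distr (Pi\<^sub>M I M) (Pi\<^sub>M I M) (\<lambda>c. c \<circ> p)) (Pi\<^sub>E I B) =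
        emeasure (Pi\<^sub>M I M) (\<Pi>\<^sub>E i\<in>I. B (inv p i))"
      using meas by (simp add: emeasure_distr)
    also have "\<dots> = (\<Prod>i\<in>I. emeasure (M i) (B (inv p i)))"
    proof (rule emeasure_PiM[OF \<open>finite I\<close>])
      show "B (inv p i) \<in> sets (M i)" if "i \<in> I" for i
        using B[of "inv p i"] q_in Mq that by simp
    qed
    \<comment> \<open>Now each factor depends on \<open>inv p i\<close> alone, so that the product
      can be reindexed.\<close>
    also have "\<dots> = (\<Prod>i\<in>I. emeasure (M (inv p i)) (B (inv p i)))"
      by (intro prod.cong) (simp_all add: Mq)
    also have "\<dots> = (\<Prod>i\<in>I. emeasure (M i) (B i))"
      by (rule prod.permute[OF q, unfolded comp_def, symmetric])
    finally show "emeasure (distr (Pi\<^sub>M I M) (Pi\<^sub>M I M) (\<lambda>c. c \<circ> p)) (Pi\<^sub>E I B) =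
        (\<Prod>i\<in>I. emeasure (M i) (B i))" .
  qed simp
qed

text \<open>Change of variables under a permutation of the particles, all of which carry the same
  one-particle measure.\<close>

lemma square_integrable_permute:
  assumes f: "square_integrable (config_measure N) f" and p: "p permutes {..<N}"
  shows "square_integrable (config_measure N) (\<lambda>c. f (c \<circ> p))"
proof -
  \<comment> \<open>Counting measure on the spin indices is sigma-finite because the type
    \<open>4\<close> is finite.\<close>
  interpret sigma_finite_measure "lborel \<Otimes>\<^sub>M count_space UNIV :: ((real ^ 3) \<times> 4) measure"
    by (intro sigma_finite_pair_measure sigma_finite_lborel sigma_finite_measure_count_space_finite) simp
  interpret product_sigma_finite
      "\<lambda>_ :: nat. lborel \<Otimes>\<^sub>M count_space UNIV :: ((real ^ 3) \<times> 4) measure"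
    by standard
  have meas: "(\<lambda>c. c \<circ> p) \<in> config_measure N \<rightarrow>\<^sub>M config_measure N"
    and distr: "distr (config_measure N) (config_measure N) (\<lambda>c. c \<circ> p) = config_measure N"
    using distr_PiM_permute[OF _ p] by (simp_all add: config_measure_def)
  have [measurable]: "f \<in> borel_measurable (config_measure N)"
    using f by (simp add: square_integrable_def)
  have "integrable (distr (config_measure N) (config_measure N) (\<lambda>c. c \<circ> p)) (\<lambda>c. (norm (f c))\<^sup>2)"
    using f by (simp add: distr square_integrable_def)
  then have "integrable (config_measure N) (\<lambda>c. (norm (f (c \<circ> p)))\<^sup>2)"
    using meas by (subst (asm) integrable_distr_eq) simp_all
  then show ?thesis
    using measurable_compose[OF meas, of f] by (simp add: square_integrable_def)
qed

lemma square_integrable_symmetrize: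
  assumes "square_integrable (config_measure N) f"
  shows "square_integrable (config_measure N) (symmetrize stat N f)"
proof -
  have "symmetrize stat N f =
      (\<lambda>c. inverse (fact N) * (\<Sum>p | p permutes {..<N}. exchange_sign stat p * f (c \<circ> p)))"
    by (simp add: fun_eq_iff symmetrize_def divide_inverse mult.commute)
  then show ?thesis
    using assms
    by (auto intro!: square_integrable_scale square_integrable_sum square_integrable_permute)
qed

text \<open>Symmetrization is a finite linear combination of permuted functions, so it maps
  representatives of classes in the tensor power to square-integrable functions.\<close>

lemma inner_space_within_sector:
  "inner_space_within (sector stat N) (carrier (L2 (config_measure N)))"
  unfolding sector_def
proof (rule inner_space_within_L2)
  show "sym_op stat N ` tensor_power N \<subseteq> carrier (L2 (config_measure N))"
    by (auto simp: sym_op_def tensor_power_def closure_in_def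
        intro!: ae_class_in_L2 square_integrable_symmetrize square_integrable_rep)
qed

theorem theorem3:
  fixes stat :: statistics
    and Nmax :: nat
    and Ht :: "(config \<Rightarrow> complex) set \<Rightarrow> (config \<Rightarrow> complex) set"
    and Dt :: "(config \<Rightarrow> complex) set set"
    and H0 H :: "(nat \<Rightarrow> (config \<Rightarrow> complex) set) \<Rightarrow> (nat \<Rightarrow> (config \<Rightarrow> complex) set)"
    and D0 D :: "(nat \<Rightarrow> (config \<Rightarrow> complex) set) set"
  assumes "Nmax \<ge> 1"
    and "essentially_self_adjoint (sector stat Nmax) Ht Dt"
    and "D0 = {(vzero (fock_below stat Nmax))(Nmax := \<phi>) | \<phi>. \<phi> \<in> Dt}"
    and "\<And>\<phi>. \<phi> \<in> Dt \<Longrightarrow>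
           H0 ((vzero (fock_below stat Nmax))(Nmax := \<phi>))
             = (vzero (fock_below stat Nmax))(Nmax := Ht \<phi>)"
    and "self_adjoint_extension (fock stat Nmax) H0 D0 H D"
  shows "\<exists>H_below D_below H_top D_top.
           linear_operator (fock_below stat Nmax) H_below D_below \<and>
           linear_operator (sector stat Nmax) H_top D_top \<and>
           D = {\<psi>\<^sub>a(Nmax := \<psi>\<^sub>b) | \<psi>\<^sub>a \<psi>\<^sub>b. \<psi>\<^sub>a \<in> D_below \<and> \<psi>\<^sub>b \<in> D_top} \<and>
           (\<forall>\<psi>\<^sub>a\<in>D_below. \<forall>\<psi>\<^sub>b\<in>D_top. H (\<psi>\<^sub>a(Nmax := \<psi>\<^sub>b)) = (H_below \<psi>\<^sub>a)(Nmax := H_top \<psi>\<^sub>b)) \<and>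
           unique_self_adjoint_extension (sector stat Nmax) Ht Dt H_top D_top"
proof -
  \<comment> \<open>This matches the index set of \<open>fock\<close> with \<open>insert k J\<close>
    for \<open>k = Nmax\<close> and \<open>J = {..<Nmax}\<close>, the index set of
    \<open>fock_below\<close>.\<close>
  have atMost: "{..Nmax} = insert Nmax {..<Nmax}"
    by auto
  show ?thesis
    unfolding fock_below_def
    by (rule top_summand_decouples[where A = "\<lambda>N. carrier (L2 (config_measure N))"])
      (use assms inner_space_within_sector in \<open>simp_all add: fock_def fock_below_def atMost\<close>)
qed

end
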